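(* Let $R$ (red points) and $B$ (blue points) be independent Poisson point processes of intensity $1$ on $\mathbb{R}$ and let $\alpha>0$ be fixed. Almost surely: (i) As $\gamma\to-\infty$, the $(\gamma,\alpha^\gamma)$-minimal matching is given by the $\alpha$-stable matching; that is, the limiting minimal matchings of $f_{\gamma,\alpha^\gamma}$ as $\gamma\to-\infty$ are the $\alpha$-stable matchings between $R$ and $B$. (ii) As $\gamma\to\infty$, the $(\gamma,\alpha^\gamma)$-minimal matching is given by the $\alpha$-altruistic matching; that is, the limiting minimal matchings of $f_{\gamma,\alpha^\gamma}$ as $\gamma\to\infty$ are the $\alpha$-altruistic matchings between $R$ and $B$.
   Context: A matching $M$ between $R$ (red) and $B$ (blue) is a set of edges $\langle x,y\rangle$, $x\in R$, $y\in B$, with each point in at most one edge; $M(x)$ is the partner of $x$. With cost function $f$, the edge $\langle x,y\rangle$ costs $f(y-x)$, and the cost of a finite matching is the sum over its edges; unmatched points count as infinite cost. For finite $R,B$ an $f$-minimal matching minimizes total cost among the matchings with as few unmatched points as possible. For a matching $M$ between countable $R,B$, call a finite set $S\subset R\cup B$ admissible for $M$ if it is a union of edges of $M$ and unmatched points, and let $M|_S$ be the restriction. For $a\in(0,\infty)$: if $\gamma>0$, $f_{\gamma,a}(x)=a|x|^\gamma$ for $x<0$ and $x^\gamma$ for $x>0$; if $\gamma<0$, $f_{\gamma,a}(x)=-a|x|^{\gamma}$ for $x<0$ and $-x^{\gamma}$ for $x>0$. $M$ is a limiting minimal matching of $f_{\gamma,\alpha^\gamma}$ as $\gamma\to-\infty$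 (resp. $\gamma\to\infty$) if for every admissible $S$, $M|_S$ is an $f_{\gamma,\alpha^\gamma}$-minimal matching between $R\cap S$ and $B\cap S$ for all sufficiently negative (resp. sufficiently large) $\gamma$. For $x\in R$ and $y\in B$ let $c(x,y)=|x-y|$ if $x\le y$ and $c(x,y)=\alpha|x-y|$ if $x>y$; put $c=\infty$ for an unmatched point and its (absent) partner. $M$ is $\alpha$-stable if for all $x\in R$, $y\in B$ not matched to each other, $\min\big(c(x,M(x)),\,c(M(y),y)\big)\le c(x,y)$. $M$ is $\alpha$-altruistic if it minimizes in dictionary (lexicographic) order the sequence of values $c(x,y)$ of its edges arranged in descending order; for infinite $R,B$ this is understood locally: for every admissible $S$, $M|_S$ is such a minimizer among the matchings between $R\cap S$ and $B\cap S$ with as few unmatched points as possible. *)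

theory Defs
  imports "HOL-Probability.Probability" "HOL-Library.List_Lexorder"
begin

section \<open>Poisson point processes on the line\<close>

text \<open>A point configuration is a locally finite set of reals.  The configurations carry the
  \<open>\<sigma>\<close>-algebra generated by the numbers of points in bounded Borel sets.\<close>

definition configurations :: "real set set" where
  "configurations = {P. \<forall>A. bounded A \<longrightarrow> finite (P \<inter> A)}"

definition configuration_space :: "real set measure" where
  "configuration_space = sigma configurations
     {{P \<in> configurations. card (P \<inter> A) = k} | A k. A \<in> sets borel \<and> bounded A}"

text \<open>The counting law is written out since \<open>poisson_pmf\<close> is only specified for positive
  rates, whereas \<open>A\<close> may be a null set (then the count is almost surely \<open>0\<close>).\<close>

definition poisson_point_process :: "'w measure \<Rightarrow> real \<Rightarrow> ('w \<Rightarrow> real set) \<Rightarrow> bool" where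
  "poisson_point_process \<Omega> intensity X \<longleftrightarrow>
     X \<in> \<Omega> \<rightarrow>\<^sub>M configuration_space \<and>
     (\<forall>A k. A \<in> sets borel \<longrightarrow> bounded A \<longrightarrow>
        (let rate = intensity * measure lborel A in
          measure \<Omega> {\<omega> \<in> space \<Omega>. card (X \<omega> \<inter> A) = k} = rate ^ k / fact k * exp (- rate))) \<and>
     (\<forall>(n::nat) (A :: nat \<Rightarrow> real set).
        (\<forall>i<n. A i \<in> sets borel \<and> bounded (A i)) \<longrightarrow> disjoint_family_on A {..<n} \<longrightarrow>
        prob_space.indep_vars \<Omega> (\<lambda>_. count_space UNIV) (\<lambda>i \<omega>. card (X \<omega> \<inter> A i)) {..<n})"

section \<open>Matchings\<close>

text \<open>An edge is a pair of a red point and a blue point, in this order.\<close>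

type_synonym matching = "(real \<times> real) set"

definition is_matching :: "real set \<Rightarrow> real set \<Rightarrow> matching \<Rightarrow> bool" where
  "is_matching R B M \<longleftrightarrow> M \<subseteq> R \<times> B \<and> inj_on fst M \<and> inj_on snd M"

definition unmatched :: "real set \<Rightarrow> real set \<Rightarrow> matching \<Rightarrow> real set" where
  "unmatched R B M = (R - fst ` M) \<union> (B - snd ` M)"

text \<open>The matchings of finite \<open>R\<close> and \<open>B\<close> with as few unmatched points as possible.\<close>

definition fewest_unmatched :: "real set \<Rightarrow> real set \<Rightarrow> matching \<Rightarrow> bool" where
  "fewest_unmatched R B = is_arg_min (\<lambda>M. card (unmatched R B M)) (is_matching R B)"

definition total_cost :: "(real \<Rightarrow> real) \<Rightarrow> matching \<Rightarrow> real" where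
  "total_cost f M = (\<Sum>(x, y)\<in>M. f (y - x))"

definition minimal_matching :: "(real \<Rightarrow> real) \<Rightarrow> real set \<Rightarrow> real set \<Rightarrow> matching \<Rightarrow> bool" where
  "minimal_matching f R B = is_arg_min (total_cost f) (fewest_unmatched R B)"

definition admissible :: "real set \<Rightarrow> real set \<Rightarrow> matching \<Rightarrow> real set \<Rightarrow> bool" where
  "admissible R B M S \<longleftrightarrow> finite S \<and>
     (\<exists>E U. E \<subseteq> M \<and> U \<subseteq> unmatched R B M \<and> S = (\<Union>(x, y)\<in>E. {x, y}) \<union> U)"

definition restrict_matching :: "matching \<Rightarrow> real set \<Rightarrow> matching" where
  "restrict_matching M S = M \<inter> S \<times> S"

section \<open>Limiting minimal matchings\<close>

text \<open>The cost function \<open>f\<^sub>\<gamma>\<^sub>,\<^sub>a\<close>, meant for \<open>\<gamma> \<noteq> 0\<close>.  Its value at \<open>0\<close>, which is \<open>0\<close> here by the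
  convention for \<open>powr\<close>, only matters if a red and a blue point coincide.\<close>

definition cost_fun :: "real \<Rightarrow> real \<Rightarrow> real \<Rightarrow> real" where
  "cost_fun \<gamma> a x =
     (if \<gamma> > 0 then (if x < 0 then a * \<bar>x\<bar> powr \<gamma> else x powr \<gamma>)
      else (if x < 0 then - a * \<bar>x\<bar> powr \<gamma> else - (x powr \<gamma>)))"

text \<open>The filter \<open>F\<close> is \<open>at_bot\<close> for \<open>\<gamma> \<rightarrow> -\<infinity>\<close> and \<open>at_top\<close> for \<open>\<gamma> \<rightarrow> \<infinity>\<close>.\<close>

definition limiting_minimal ::
    "real filter \<Rightarrow> real \<Rightarrow> real set \<Rightarrow> real set \<Rightarrow> matching \<Rightarrow> bool" where
  "limiting_minimal F \<alpha> R B M \<longleftrightarrow> is_matching R B M \<and>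
     (\<forall>S. admissible R B M S \<longrightarrow>
        (\<forall>\<^sub>F \<gamma> in F. minimal_matching (cost_fun \<gamma> (\<alpha> powr \<gamma>)) (R \<inter> S) (B \<inter> S)
                     (restrict_matching M S)))"

section \<open>Stable and altruistic matchings\<close>

definition pair_cost :: "real \<Rightarrow> real \<Rightarrow> real \<Rightarrow> real" where
  "pair_cost \<alpha> x y = (if x \<le> y then \<bar>x - y\<bar> else \<alpha> * \<bar>x - y\<bar>)"

text \<open>\<open>pair_cost\<close> is the function \<open>c\<close> on pairs of points; \<open>red_cost\<close> and \<open>blue_cost\<close> are the extended real
  numbers \<open>c(x, M(x))\<close> and \<open>c(M(y), y)\<close>, infinite for unmatched points.\<close>

definition red_cost :: "real \<Rightarrow> matching \<Rightarrow> real \<Rightarrow> ereal" where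
  "red_cost \<alpha> M x = (if x \<in> fst ` M then ereal (pair_cost \<alpha> x (THE y. (x, y) \<in> M)) else \<infinity>)"

definition blue_cost :: "real \<Rightarrow> matching \<Rightarrow> real \<Rightarrow> ereal" where
  "blue_cost \<alpha> M y = (if y \<in> snd ` M then ereal (pair_cost \<alpha> (THE x. (x, y) \<in> M) y) else \<infinity>)"

definition stable_matching :: "real \<Rightarrow> real set \<Rightarrow> real set \<Rightarrow> matching \<Rightarrow> bool" where
  "stable_matching \<alpha> R B M \<longleftrightarrow> is_matching R B M \<and>
     (\<forall>x\<in>R. \<forall>y\<in>B. (x, y) \<notin> M \<longrightarrow> min (red_cost \<alpha> M x) (blue_cost \<alpha> M y) \<le> ereal (pair_cost \<alpha> x y))"

text \<open>The values \<open>c(x, y)\<close> over the edges of a finite matching, with repetitions, in descending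
  order.  Lists are compared in dictionary order.\<close>

definition descending_costs :: "real \<Rightarrow> matching \<Rightarrow> real list" where
  "descending_costs \<alpha> M =
     rev (sorted_list_of_multiset (image_mset (\<lambda>(x, y). pair_cost \<alpha> x y) (mset_set M)))"

definition finite_altruistic :: "real \<Rightarrow> real set \<Rightarrow> real set \<Rightarrow> matching \<Rightarrow> bool" where
  "finite_altruistic \<alpha> R B = is_arg_min (descending_costs \<alpha>) (fewest_unmatched R B)"

definition altruistic_matching :: "real \<Rightarrow> real set \<Rightarrow> real set \<Rightarrow> matching \<Rightarrow> bool" where
  "altruistic_matching \<alpha> R B M \<longleftrightarrow> is_matching R B M \<and>
     (\<forall>S. admissible R B M S \<longrightarrow>
        finite_altruistic \<alpha> (R \<inter> S) (B \<inter> S) (restrict_matching M S))"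

end

theory Submission
  imports Defs "HOL-Real_Asymp.Real_Asymp"
begin

text \<open>Up to its sign, the cost of an edge is \<open>c(x, y) powr \<gamma>\<close>, so as \<open>\<gamma> \<rightarrow> \<infinity>\<close> finite matchings of the
  same points are eventually ordered like their descending lists of costs in dictionary order.
  As \<open>\<gamma> \<rightarrow> -\<infinity>\<close> the cheapest edge dominates.  If \<open>x\<close>, \<open>y\<close> block \<open>M\<close>, it is thus eventually
  profitable to match them with each other and their former partners with each other.  Conversely, a
  stable matching wins against any other one at the cheapest edge in which they differ, provided
  that no two edges at a common point have the same cost.
  Such a coincidence is a relation \<open>x = t y + (1 - t) y'\<close>, with \<open>t = \<alpha> / (1 + \<alpha>)\<close>,
  between a point of one process and two points of the other one, and almost surely there is none.
  The case \<open>y = y'\<close> gives the disjointness of \<open>R\<close> and \<open>B\<close>.\<close>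

section \<open>Coincidences between independent Poisson processes\<close>

lemma space_configuration_space: "space configuration_space = configurations"
  unfolding configuration_space_def by (rule space_measure_of) auto

text \<open>The processes enter only through these events: a coincidence forces hits of short
  intervals, and hits have simple probability bounds.\<close>

definition hitting :: "real set \<Rightarrow> real set set" where
  "hitting A = {P \<in> configurations. P \<inter> A \<noteq> {}}"

text \<open>\<open>card\<close> is also 0 on infinite sets; local finiteness and boundedness of
  \<open>A\<close> rule that case out.\<close>

lemma hitting_eq:
  assumes "bounded A"
  shows "hitting A = configurations - {P \<in> configurations. card (P \<inter> A) = 0}"
  using assms unfolding hitting_def configurations_def by auto

lemma hitting_sets:
  assumes "A \<in> sets borel" "bounded A"
  shows "hitting A \<in> sets configuration_space"
proof -
  have "{P \<in> configurations. card (P \<inter> A) = 0} \<in> sets configuration_space"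
    unfolding configuration_space_def by (rule in_measure_of) (use assms in auto)
  then have "space configuration_space - {P \<in> configurations. card (P \<inter> A) = 0}
      \<in> sets configuration_space"
    by (rule sets.compl_sets)
  then show ?thesis
    unfolding hitting_eq[OF assms(2)] space_configuration_space .
qed

context prob_space
begin

lemma poisson_measurable:
  "poisson_point_process M r X \<Longrightarrow> X \<in> M \<rightarrow>\<^sub>M configuration_space"
  unfolding poisson_point_process_def by blast

lemma poisson_hitting_vimage:
  assumes "poisson_point_process M r X" "bounded A"
  shows "X -` hitting A \<inter> space M = {\<omega> \<in> space M. card (X \<omega> \<inter> A) \<noteq> 0}"
  using measurable_space[OF poisson_measurable[OF assms(1)]] assms(2)
  unfolding hitting_eq[OF assms(2)] space_configuration_space by auto

text \<open>The void probability is \<open>exp (-u)\<close> with \<open>u\<close> the length of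
  \<open>A\<close>, and \<open>1 - exp (-u) \<le> u\<close>.\<close>

lemma poisson_hitting_prob:
  assumes X: "poisson_point_process M 1 X" and A: "A \<in> sets borel" "bounded A"
  shows "prob (X -` hitting A \<inter> space M) \<le> measure lborel A"
proof -
  let ?Z = "{\<omega> \<in> space M. card (X \<omega> \<inter> A) = 0}"
  have H: "X -` hitting A \<inter> space M \<in> events"
    using poisson_measurable[OF X] hitting_sets[OF A] by (rule measurable_sets)
  have eq: "?Z = space M - (X -` hitting A \<inter> space M)"
    unfolding poisson_hitting_vimage[OF X A(2)] by auto
  have "prob ?Z = exp (- measure lborel A)"
  proof -
    have "prob ?Z = (1 * measure lborel A) ^ 0 / fact 0 * exp (- (1 * measure lborel A))"
      using X A unfolding poisson_point_process_def Let_def by blast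
    then show ?thesis by simp
  qed
  then have "prob (X -` hitting A \<inter> space M) = 1 - exp (- measure lborel A)"
    unfolding eq prob_compl[OF H] by simp
  then show ?thesis
    using exp_ge_add_one_self[of "- measure lborel A"] by simp
qed

lemma poisson_hitting_disjoint_prob:
  assumes X: "poisson_point_process M 1 X"
    and A: "A \<in> sets borel" "bounded A" and B: "B \<in> sets borel" "bounded B"
    and disj: "A \<inter> B = {}"
  shows "prob (X -` (hitting A \<inter> hitting B) \<inter> space M) \<le> measure lborel A * measure lborel B"
proof -
  \<comment> \<open>Independence of counts is formulated for families indexed by
    \<open>{..<n}\<close>, so the two sets become such a family with \<open>n = 2\<close>.\<close>
  define C where "C i = (if i = 0 then A else B)" for i :: nat
  have C: "\<forall>i<2. C i \<in> sets borel \<and> bounded (C i)" and "disjoint_family_on C {..<2}"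
    using A B disj by (auto simp: C_def disjoint_family_on_def)
  with X have ind: "indep_vars (\<lambda>_. count_space UNIV) (\<lambda>i \<omega>. card (X \<omega> \<inter> C i)) {..<2::nat}"
    unfolding poisson_point_process_def by blast
  have "prob (\<Inter>j\<in>{..<2::nat}. (\<lambda>\<omega>. card (X \<omega> \<inter> C j)) -` (- {0}) \<inter> space M) =
      (\<Prod>j\<in>{..<2::nat}. prob ((\<lambda>\<omega>. card (X \<omega> \<inter> C j)) -` (- {0}) \<inter> space M))"
    by (rule indep_varsD[OF ind]) (auto simp: lessThan_empty_iff)
  also have "(\<Inter>j\<in>{..<2::nat}. (\<lambda>\<omega>. card (X \<omega> \<inter> C j)) -` (- {0}) \<inter> space M)
      = (X -` hitting A \<inter> space M) \<inter> (X -` hitting B \<inter> space M)"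
    unfolding poisson_hitting_vimage[OF X A(2)] poisson_hitting_vimage[OF X B(2)]
    by (auto simp: C_def numeral_2_eq_2 lessThan_Suc simp del: card_eq_0_iff card_0_eq)
  also have "\<dots> = X -` (hitting A \<inter> hitting B) \<inter> space M" by auto
  also have "(\<Prod>j\<in>{..<2::nat}. prob ((\<lambda>\<omega>. card (X \<omega> \<inter> C j)) -` (- {0}) \<inter> space M))
      = prob (X -` hitting A \<inter> space M) * prob (X -` hitting B \<inter> space M)"
  proof -
    have "(\<lambda>\<omega>. card (X \<omega> \<inter> D)) -` (- {0}) \<inter> space M = {\<omega> \<in> space M. card (X \<omega> \<inter> D) \<noteq> 0}" for D
      by auto
    then show ?thesis
      unfolding poisson_hitting_vimage[OF X A(2)] poisson_hitting_vimage[OF X B(2)]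
      by (simp add: C_def numeral_2_eq_2 lessThan_Suc mult.commute)
  qed
  finally show ?thesis
    using poisson_hitting_prob[OF X A] poisson_hitting_prob[OF X B] by (simp add: mult_mono)
qed

text \<open>Allows the avoidance result, which takes one point of the first process and two of the
  second, to be applied with the colours exchanged.\<close>

lemma indep_var_commute:
  assumes "indep_var S X T Y"
  shows "indep_var T Y S X"
proof -
  have "indep_set U V \<Longrightarrow> indep_set V U" for U V
    unfolding indep_sets2_eq by (metis Int_commute mult.commute)
  then show ?thesis using assms unfolding indep_var_eq by blast
qed

text \<open>The predicate \<open>Q\<close> may be non-measurable; it is enclosed in the intersection
  of the \<open>E k\<close>, which is measurable and null because \<open>C / Suc k\<close> tends to
  0.\<close>

lemma AE_not_of_small_events:
  assumes E: "\<And>k::nat. E k \<in> events" and "\<And>k. prob (E k) \<le> C / Suc k"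
    and sub: "\<And>k \<omega>. \<omega> \<in> space M \<Longrightarrow> Q \<omega> \<Longrightarrow> \<omega> \<in> E k"
  shows "AE \<omega> in M. \<not> Q \<omega>"
proof -
  have I: "(\<Inter>k. E k) \<in> events" using E by auto
  have "(\<lambda>k. C / Suc k) \<longlonglongrightarrow> 0" by real_asymp
  moreover have "prob (\<Inter>k. E k) \<le> C / Suc k" for k
    using assms(2)[of k] finite_measure_mono[OF _ E, of "\<Inter>k. E k" k] by (meson INF_lower UNIV_I order_trans)
  ultimately have "prob (\<Inter>k. E k) \<le> 0"
    by (intro tendsto_lowerbound) auto
  then have "(\<Inter>k. E k) \<in> null_sets M"
    using I by (auto simp: null_sets_def emeasure_eq_measure measure_le_0_iff)
  then show ?thesis
    by (rule AE_I') (use sub in auto)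
qed

text \<open>Cut \<open>[-n, n)\<close> into cells of length \<open>h\<close>.  The cells of \<open>y\<close> and \<open>y'\<close> confine \<open>x\<close> to an
  interval of length \<open>h\<close>, so the expected number of bad pairs of cells is at most
  \<open>(2 n / h)\<^sup>2 h\<^sup>3 + (2 n / h) h\<^sup>2\<close>.\<close>

lemma AE_poisson_avoids_bounded_combinations:
  fixes n :: nat
  assumes R: "poisson_point_process M 1 R" and B: "poisson_point_process M 1 B"
    and ind: "indep_var configuration_space R configuration_space B"
    and t: "0 \<le> t" "t \<le> 1"
  shows "AE \<omega> in M. \<not> (\<exists>x\<in>R \<omega>. \<exists>y\<in>B \<omega>. \<exists>y'\<in>B \<omega>.
    y \<in> {- real n..<real n} \<and> y' \<in> {- real n..<real n} \<and> x = t * y + (1 - t) * y')"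
proof -
  \<comment> \<open>The index \<open>z\<close> is real: integer indices give the grid cells of
    \<open>y\<close> and \<open>y'\<close>, while the interval for \<open>x\<close> starts at a
    convex combination of grid points.\<close>
  define cell where "cell h z = {z * h..<z * h + h}" for h z :: real
  have cell [simp]: "cell h z \<in> sets borel" "bounded (cell h z)" for h z
    by (auto simp: cell_def intro: bounded_subset[OF bounded_closed_interval])
  have cell_measure: "measure lborel (cell h z) = h" if "0 < h" for h z
    using that by (simp add: cell_def)
  define h where "h k = 1 / real (Suc k)" for k
  have h_pos: "h k > 0" for k by (simp add: h_def)
  \<comment> \<open>The grid cells covering \<open>[-n, n)\<close>, since
    \<open>n / h k = n * Suc k\<close>.\<close>
  define J :: "nat \<Rightarrow> int set" where "J k = {- int (n * Suc k)..<int (n * Suc k)}" for k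
  define HB where "HB k p = B -` (hitting (cell (h k) (of_int (fst p))) \<inter> hitting (cell (h k) (of_int (snd p))))
      \<inter> space M" for k and p :: "int \<times> int"
  define HR where "HR k p = R -` hitting (cell (h k) (t * of_int (fst p) + (1 - t) * of_int (snd p))) \<inter> space M"
    for k and p :: "int \<times> int"
  define E where "E k = (\<Union>p \<in> J k \<times> J k. HR k p \<inter> HB k p)" for k
  have HB_sets: "HB k p \<in> events" for k p
    unfolding HB_def using poisson_measurable[OF B]
    by (intro measurable_sets[of _ _ configuration_space] sets.Int hitting_sets) auto
  have HR_sets: "HR k p \<in> events" for k p
    unfolding HR_def using poisson_measurable[OF R]
    by (intro measurable_sets[of _ _ configuration_space] sets.Int hitting_sets) auto
  have E_sets: "E k \<in> events" for k
    unfolding E_def J_def using HB_sets HR_sets by (intro sets.finite_UN sets.Int) auto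
  have prod: "prob (HR k p \<inter> HB k p) = prob (HR k p) * prob (HB k p)" for k p
  proof -
    define X where "X = hitting (cell (h k) (t * of_int (fst p) + (1 - t) * of_int (snd p)))"
    define Y where "Y = hitting (cell (h k) (of_int (fst p))) \<inter> hitting (cell (h k) (of_int (snd p)))"
    have "prob ((\<lambda>\<omega>. (R \<omega>, B \<omega>)) -` (X \<times> Y) \<inter> space M)
        = prob (R -` X \<inter> space M) * prob (B -` Y \<inter> space M)"
      by (rule indep_varD[OF ind]) (auto simp: X_def Y_def hitting_sets)
    moreover have "(\<lambda>\<omega>. (R \<omega>, B \<omega>)) -` (X \<times> Y) \<inter> space M
        = (R -` X \<inter> space M) \<inter> (B -` Y \<inter> space M)" by auto
    ultimately show ?thesis unfolding HR_def HB_def X_def Y_def by simp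
  qed
  have HR_prob: "prob (HR k p) \<le> h k" for k p
    using poisson_hitting_prob[OF R cell, of "h k"] cell_measure[OF h_pos] by (simp add: HR_def)
  \<comment> \<open>On the diagonal the two cells coincide and only one factor \<open>h k\<close> is
    gained; this is affordable since only \<open>2 n / h k\<close> pairs are diagonal.\<close>
  have HB_prob: "prob (HB k p) \<le> (if fst p = snd p then h k else h k * h k)" for k p
  proof (cases "fst p = snd p")
    case True
    then show ?thesis
      using poisson_hitting_prob[OF B cell, of "h k" "of_int (fst p)"] cell_measure[OF h_pos]
      by (simp add: HB_def)
  next
    case False
    have "cell (h k) (of_int i) \<inter> cell (h k) (of_int j) = {}" if "i < j" for i j
    proof -
      have "(of_int i + 1) * h k \<le> of_int j * h k"
        using that h_pos[of k] by (intro mult_right_mono) linarith+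
      then show ?thesis by (auto simp: cell_def algebra_simps)
    qed
    then have "cell (h k) (of_int (fst p)) \<inter> cell (h k) (of_int (snd p)) = {}"
      using False by (metis inf_commute linorder_neqE)
    from poisson_hitting_disjoint_prob[OF B cell cell this] show ?thesis
      using False cell_measure[OF h_pos] by (simp add: HB_def)
  qed
  have E_prob: "prob (E k) \<le> (4 * real n ^ 2 + 2 * real n) / Suc k" for k
  proof -
    have fin: "finite (J k)" and card: "real (card (J k)) = 2 * real n * Suc k"
      by (auto simp: J_def algebra_simps)
    have "prob (E k) \<le> (\<Sum>p\<in>J k \<times> J k. prob (HR k p \<inter> HB k p))"
      unfolding E_def using fin HB_sets HR_sets
      by (intro finite_measure_subadditive_finite) auto
    \<comment> \<open>Adding the diagonal term instead of distinguishing cases lets the double sum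
      split into a full sum and a diagonal sum.\<close>
    also have "\<dots> \<le> (\<Sum>p\<in>J k \<times> J k. h k * (h k * h k + (if fst p = snd p then h k else 0)))"
    proof (rule sum_mono)
      fix p
      have "prob (HB k p) \<le> h k * h k + (if fst p = snd p then h k else 0)"
        using HB_prob[of k p] h_pos[of k] by (auto intro: order_trans split: if_splits)
      then show "prob (HR k p \<inter> HB k p) \<le> h k * (h k * h k + (if fst p = snd p then h k else 0))"
        unfolding prod using HR_prob h_pos[of k] by (intro mult_mono) auto
    qed
    also have "\<dots> = (\<Sum>i\<in>J k. \<Sum>j\<in>J k. h k * h k * h k + (if i = j then h k * h k else 0))"
      unfolding sum.cartesian_product case_prod_unfold
      by (intro sum.cong) (auto simp: algebra_simps)
    also have "\<dots> = real (card (J k)) * real (card (J k)) * (h k * h k * h k) + real (card (J k)) * (h k * h k)"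
      using fin by (simp add: sum.distrib algebra_simps)
    also have "\<dots> = (4 * real n ^ 2 + 2 * real n) / Suc k"
      unfolding card h_def by (simp add: field_simps power2_eq_square del: of_nat_Suc)
    finally show ?thesis .
  qed
  have R_conf: "R \<omega> \<in> configurations" and B_conf: "B \<omega> \<in> configurations" if "\<omega> \<in> space M" for \<omega>
    using measurable_space[OF poisson_measurable[OF R] that]
      measurable_space[OF poisson_measurable[OF B] that] by (auto simp: space_configuration_space)
  show ?thesis
  proof (rule AE_not_of_small_events[OF E_sets E_prob], elim bexE conjE)
    fix k \<omega> x y y'
    assume \<omega>: "\<omega> \<in> space M" and mem: "x \<in> R \<omega>" "y \<in> B \<omega>" "y' \<in> B \<omega>"
      and y: "y \<in> {- real n..<real n}" "y' \<in> {- real n..<real n}"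
      and x: "x = t * y + (1 - t) * y'"
    \<comment> \<open>As \<open>1 / h k = Suc k\<close>, rounding down \<open>z * Suc k\<close>
      gives the index of the grid cell containing \<open>z\<close>.\<close>
    have idx: "\<lfloor>z * Suc k\<rfloor> \<in> J k" "z \<in> cell (h k) (of_int \<lfloor>z * Suc k\<rfloor>)"
      if "z \<in> {- real n..<real n}" for z
    proof -
      have "- real n * Suc k \<le> z * Suc k" "z * Suc k < real n * Suc k"
        using that mult_right_mono[of "- real n" z "real (Suc k)"]
          mult_strict_right_mono[of z "real n" "real (Suc k)"] by (simp_all del: of_nat_Suc)
      then have "of_int (- int (n * Suc k)) \<le> z * Suc k" "z * Suc k < of_int (int (n * Suc k))"
        by (simp_all only: of_int_minus of_int_of_nat_eq of_int_mult of_nat_mult mult_minus_left)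
      then show "\<lfloor>z * Suc k\<rfloor> \<in> J k"
        unfolding J_def by (simp add: le_floor_iff floor_less_iff del: of_nat_Suc of_nat_mult)
      have "of_int \<lfloor>z * Suc k\<rfloor> \<le> z * Suc k" "z * Suc k < of_int \<lfloor>z * Suc k\<rfloor> + 1"
        by (rule of_int_floor_le, rule real_of_int_floor_add_one_gt)
      then show "z \<in> cell (h k) (of_int \<lfloor>z * Suc k\<rfloor>)"
        unfolding cell_def h_def by (simp add: field_simps del: of_nat_Suc)
    qed
    define p where "p = (\<lfloor>y * Suc k\<rfloor>, \<lfloor>y' * Suc k\<rfloor>)"
    have "x \<in> cell (h k) (t * of_int (fst p) + (1 - t) * of_int (snd p))"
    proof -
      define i j where "i = of_int (fst p) * h k" and "j = of_int (snd p) * h k"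
      have ij: "i \<le> y" "y < i + h k" "j \<le> y'" "y' < j + h k"
        using idx(2)[OF y(1)] idx(2)[OF y(2)] unfolding cell_def p_def i_def j_def by auto
      have "t * i + (1 - t) * j \<le> x"
        unfolding x using ij t by (intro add_mono mult_left_mono) auto
      \<comment> \<open>The weights sum to 1, so the offset stays below \<open>h k\<close>.
        Strictness comes from the second summand if \<open>t = 0\<close>, otherwise from the
        first.\<close>
      moreover have "t * y + (1 - t) * y' < t * (i + h k) + (1 - t) * (j + h k)"
      proof (cases "t = 0")
        case True then show ?thesis using ij by simp
      next
        case False
        then show ?thesis using ij t
          by (intro add_less_le_mono mult_strict_left_mono mult_left_mono) auto
      qed
      ultimately show ?thesis
        unfolding x cell_def i_def j_def by (simp add: algebra_simps)
    qed
    then have "\<omega> \<in> HR k p \<inter> HB k p"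
      using mem idx(2)[OF y(1)] idx(2)[OF y(2)] \<omega> R_conf[OF \<omega>] B_conf[OF \<omega>]
      unfolding HR_def HB_def hitting_def p_def by auto
    moreover have "p \<in> J k \<times> J k"
      using idx(1) y by (simp add: p_def)
    ultimately show "\<omega> \<in> E k" unfolding E_def by blast
  qed
qed

text \<open>Countably many windows \<open>[-n, n)\<close> exhaust the line.\<close>

lemma AE_poisson_avoids_combinations:
  assumes "poisson_point_process M 1 R" "poisson_point_process M 1 B"
    and "indep_var configuration_space R configuration_space B"
    and "0 \<le> t" "t \<le> 1"
  shows "AE \<omega> in M. \<forall>x\<in>R \<omega>. \<forall>y\<in>B \<omega>. \<forall>y'\<in>B \<omega>. x \<noteq> t * y + (1 - t) * y'"
proof -
  have "AE \<omega> in M. \<forall>n::nat. \<not> (\<exists>x\<in>R \<omega>. \<exists>y\<in>B \<omega>. \<exists>y'\<in>B \<omega>.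
    y \<in> {- real n..<real n} \<and> y' \<in> {- real n..<real n} \<and> x = t * y + (1 - t) * y')"
    unfolding AE_all_countable by (intro allI AE_poisson_avoids_bounded_combinations[OF assms])
  then show ?thesis
  proof (rule AE_mp, intro AE_I2 impI ballI notI)
    fix \<omega> x y y'
    assume *: "\<forall>n::nat. \<not> (\<exists>x\<in>R \<omega>. \<exists>y\<in>B \<omega>. \<exists>y'\<in>B \<omega>.
        y \<in> {- real n..<real n} \<and> y' \<in> {- real n..<real n} \<and> x = t * y + (1 - t) * y')"
      and **: "x \<in> R \<omega>" "y \<in> B \<omega>" "y' \<in> B \<omega>" "x = t * y + (1 - t) * y'"
    obtain n :: nat where "max \<bar>y\<bar> \<bar>y'\<bar> < real n" using reals_Archimedean2 by blast
    then have "y \<in> {- real n..<real n}" "y' \<in> {- real n..<real n}" by auto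
    with * ** show False by blast
  qed
qed

end

section \<open>Finite and restricted matchings\<close>

lemma is_arg_min_mono:
  fixes f :: "'a \<Rightarrow> 'b :: order"
  shows "is_arg_min f P x \<Longrightarrow> P y \<Longrightarrow> f y \<le> f x \<Longrightarrow> is_arg_min f P y"
  unfolding is_arg_min_def by (meson order.strict_trans2)

lemma is_matchingD_fst: "is_matching R B M \<Longrightarrow> (x, y) \<in> M \<Longrightarrow> (x, z) \<in> M \<Longrightarrow> y = z"
  unfolding is_matching_def inj_on_def by fastforce

lemma is_matchingD_snd: "is_matching R B M \<Longrightarrow> (x, y) \<in> M \<Longrightarrow> (z, y) \<in> M \<Longrightarrow> x = z"
  unfolding is_matching_def inj_on_def by fastforce

lemma red_cost_eq: "is_matching R B M \<Longrightarrow> (x, y) \<in> M \<Longrightarrow> red_cost \<alpha> M x = ereal (pair_cost \<alpha> x y)"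
  unfolding red_cost_def by (force dest: is_matchingD_fst intro: arg_cong[of _ _ "pair_cost \<alpha> x"])

lemma blue_cost_eq: "is_matching R B M \<Longrightarrow> (x, y) \<in> M \<Longrightarrow> blue_cost \<alpha> M y = ereal (pair_cost \<alpha> x y)"
  unfolding blue_cost_def by (force dest: is_matchingD_snd intro: arg_cong[of _ _ "\<lambda>x. pair_cost \<alpha> x y"])

text \<open>Absence of blocking pairs without \<open>THE\<close> and infinite values: an unmatched
  point has infinite cost, so only an actual edge can satisfy the inequality.\<close>

lemma stable_matching_iff:
  "stable_matching \<alpha> R B M \<longleftrightarrow> is_matching R B M \<and>
     (\<forall>x\<in>R. \<forall>y\<in>B. (x, y) \<notin> M \<longrightarrow>
       (\<exists>y'. (x, y') \<in> M \<and> pair_cost \<alpha> x y' \<le> pair_cost \<alpha> x y) \<or>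
       (\<exists>x'. (x', y) \<in> M \<and> pair_cost \<alpha> x' y \<le> pair_cost \<alpha> x y))"
proof (cases "is_matching R B M")
  case True
  have "red_cost \<alpha> M x \<le> ereal c \<longleftrightarrow> (\<exists>y'. (x, y') \<in> M \<and> pair_cost \<alpha> x y' \<le> c)" for x c
  proof (cases "\<exists>y'. (x, y') \<in> M")
    case True
    then show ?thesis
      using red_cost_eq[OF \<open>is_matching R B M\<close>] is_matchingD_fst[OF \<open>is_matching R B M\<close>]
      by (metis ereal_less_eq(3))
  qed (force simp: red_cost_def)
  moreover have "blue_cost \<alpha> M y \<le> ereal c \<longleftrightarrow> (\<exists>x'. (x', y) \<in> M \<and> pair_cost \<alpha> x' y \<le> c)" for y c
  proof (cases "\<exists>x'. (x', y) \<in> M")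
    case True
    then show ?thesis
      using blue_cost_eq[OF \<open>is_matching R B M\<close>] is_matchingD_snd[OF \<open>is_matching R B M\<close>]
      by (metis ereal_less_eq(3))
  qed (force simp: blue_cost_def)
  ultimately show ?thesis
    unfolding stable_matching_def min_le_iff_disj by simp
qed (simp add: stable_matching_def)

text \<open>Each edge uses two distinct points, as the colours are disjoint. Hence fewest unmatched
  points means most edges.\<close>

lemma card_unmatched:
  assumes "finite R" "finite B" "R \<inter> B = {}" "is_matching R B M"
  shows "card (unmatched R B M) + 2 * card M = card R + card B"
proof -
  have sub: "fst ` M \<subseteq> R" "snd ` M \<subseteq> B" and inj: "inj_on fst M" "inj_on snd M"
    using assms(4) unfolding is_matching_def by auto
  have "card (unmatched R B M) = card (R - fst ` M) + card (B - snd ` M)"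
    unfolding unmatched_def using assms(1-3) by (intro card_Un_disjoint) auto
  moreover have "card (R - fst ` M) + card M = card R" "card (B - snd ` M) + card M = card B"
    using sub inj assms(1,2)
    by (metis card_Diff_subset card_image card_mono finite_subset le_add_diff_inverse2)+
  ultimately show ?thesis by simp
qed

lemma finite_matchings: "finite R \<Longrightarrow> finite B \<Longrightarrow> finite {M. is_matching R B M}"
  by (rule finite_subset[of _ "Pow (R \<times> B)"]) (auto simp: is_matching_def)

lemma is_matching_restrict:
  "is_matching R B M \<Longrightarrow> is_matching (R \<inter> S) (B \<inter> S) (restrict_matching M S)"
  unfolding is_matching_def restrict_matching_def by (auto intro: inj_on_subset)

text \<open>An endpoint in \<open>S\<close> is matched, so it comes from an edge in
  \<open>E\<close>; disjoint colours and unique partners force that edge to be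
  \<open>(x, y)\<close>.\<close>

lemma admissible_edge:
  assumes "is_matching R B M" "R \<inter> B = {}" "admissible R B M S" "(x, y) \<in> M"
  shows "x \<in> S \<longleftrightarrow> y \<in> S"
proof -
  obtain E U where E: "E \<subseteq> M" and U: "U \<subseteq> unmatched R B M"
    and S: "S = (\<Union>(x, y)\<in>E. {x, y}) \<union> U"
    using assms(3) unfolding admissible_def by blast
  have xy: "x \<in> R" "y \<in> B" and "x \<notin> B" "y \<notin> R"
    using assms(1,2,4) unfolding is_matching_def by auto
  then have "x \<notin> U" "y \<notin> U"
    using U assms(4) unfolding unmatched_def by force+
  have "(x, y) \<in> E" if "z \<in> {x, y}" "z \<in> S" for z
  proof -
    have "z \<in> (\<Union>(x, y)\<in>E. {x, y})"
      using that \<open>x \<notin> U\<close> \<open>y \<notin> U\<close> S by blast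
    then obtain a b where ab: "(a, b) \<in> E" "z = a \<or> z = b" by auto
    then have "(a, b) \<in> M" "a \<in> R" "b \<in> B" using E assms(1) unfolding is_matching_def by auto
    then show ?thesis
      using ab that(1) \<open>x \<notin> B\<close> \<open>y \<notin> R\<close> assms(4) is_matchingD_fst[OF assms(1)] is_matchingD_snd[OF assms(1)]
      by blast
  qed
  moreover have "x \<in> S \<and> y \<in> S" if "(x, y) \<in> E"
    using UN_I[OF that, of _ "\<lambda>(x, y). {x, y}"] by (auto simp: S)
  ultimately show ?thesis by blast
qed

text \<open>The edge witnessing stability for \<open>x\<close> and \<open>y\<close> has one of them
  as an endpoint, so it lies entirely inside \<open>S\<close>.\<close>

lemma stable_matching_restrict:
  assumes "stable_matching \<alpha> R B M" "R \<inter> B = {}" "admissible R B M S"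
  shows "stable_matching \<alpha> (R \<inter> S) (B \<inter> S) (restrict_matching M S)"
proof -
  have match: "is_matching R B M" using assms(1) by (simp add: stable_matching_iff)
  have edge: "(a, b) \<in> restrict_matching M S" if "(a, b) \<in> M" "a \<in> S \<or> b \<in> S" for a b
    using that admissible_edge[OF match assms(2,3) that(1)] by (auto simp: restrict_matching_def)
  show ?thesis
    unfolding stable_matching_iff
  proof (intro conjI ballI impI)
    fix x y assume "x \<in> R \<inter> S" "y \<in> B \<inter> S" "(x, y) \<notin> restrict_matching M S"
    moreover from this have "(x, y) \<notin> M" using edge by blast
    ultimately have "x \<in> S" "y \<in> S"
      "(\<exists>y'. (x, y') \<in> M \<and> pair_cost \<alpha> x y' \<le> pair_cost \<alpha> x y) \<or>
       (\<exists>x'. (x', y) \<in> M \<and> pair_cost \<alpha> x' y \<le> pair_cost \<alpha> x y)"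
      using assms(1) unfolding stable_matching_iff by auto
    then show "(\<exists>y'. (x, y') \<in> restrict_matching M S \<and> pair_cost \<alpha> x y' \<le> pair_cost \<alpha> x y) \<or>
        (\<exists>x'. (x', y) \<in> restrict_matching M S \<and> pair_cost \<alpha> x' y \<le> pair_cost \<alpha> x y)"
      using edge by blast
  qed (rule is_matching_restrict[OF match])
qed

section \<open>Large exponents and altruistic matchings\<close>

lemma pair_cost_pos: "\<alpha> > 0 \<Longrightarrow> x \<noteq> y \<Longrightarrow> pair_cost \<alpha> x y > 0"
  unfolding pair_cost_def by auto

text \<open>The factor \<alpha> inside \<open>pair_cost\<close> turns into
  \<open>\<alpha> powr \<gamma>\<close> because powers are multiplicative.\<close>

lemma cost_fun_eq:
  assumes "\<alpha> > 0"
  shows "cost_fun \<gamma> (\<alpha> powr \<gamma>) (y - x) =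
    (if \<gamma> > 0 then pair_cost \<alpha> x y powr \<gamma> else - (pair_cost \<alpha> x y powr \<gamma>))"
  using assms unfolding cost_fun_def pair_cost_def by (auto simp: powr_mult abs_minus_commute)

lemma total_cost_eq:
  assumes "\<alpha> > 0"
  shows "\<gamma> > 0 \<Longrightarrow> total_cost (cost_fun \<gamma> (\<alpha> powr \<gamma>)) M = (\<Sum>(x, y)\<in>M. pair_cost \<alpha> x y powr \<gamma>)"
    and "\<gamma> \<le> 0 \<Longrightarrow> total_cost (cost_fun \<gamma> (\<alpha> powr \<gamma>)) M = - (\<Sum>(x, y)\<in>M. pair_cost \<alpha> x y powr \<gamma>)"
  unfolding total_cost_def
  by (simp_all add: cost_fun_eq[OF assms] case_prod_unfold sum_negf)

section \<open>Asymptotic domination in sums of powers\<close>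

lemma powr_tendsto_0:
  fixes a :: real
  shows "0 < a \<Longrightarrow> a < 1 \<Longrightarrow> ((\<lambda>\<gamma>. a powr \<gamma>) \<longlongrightarrow> 0) at_top"
    and "1 < a \<Longrightarrow> ((\<lambda>\<gamma>. a powr \<gamma>) \<longlongrightarrow> 0) at_bot"
proof -
  assume "0 < a" "a < 1"
  then have "ln a < 0" by simp
  then have "((\<lambda>\<gamma>. exp (\<gamma> * ln a)) \<longlongrightarrow> 0) at_top" by real_asymp
  then show "((\<lambda>\<gamma>. a powr \<gamma>) \<longlongrightarrow> 0) at_top" using \<open>0 < a\<close> by (simp add: powr_def)
next
  assume "1 < a"
  then have "ln a > 0" by simp
  then have "((\<lambda>\<gamma>. exp (\<gamma> * ln a)) \<longlongrightarrow> 0) at_bot" by real_asymp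
  then show "((\<lambda>\<gamma>. a powr \<gamma>) \<longlongrightarrow> 0) at_bot" using \<open>1 < a\<close> by (simp add: powr_def)
qed

text \<open>After division by \<open>c powr \<gamma>\<close> every base exceeds 1, so each summand
  tends to 0.\<close>

lemma eventually_sum_powr_less_at_bot:
  fixes f :: "'a \<Rightarrow> real"
  assumes "0 < c" "\<And>a. a \<in> A \<Longrightarrow> c < f a"
  shows "\<forall>\<^sub>F \<gamma> in at_bot. (\<Sum>a\<in>A. f a powr \<gamma>) < c powr \<gamma>"
proof -
  have "((\<lambda>\<gamma>. \<Sum>a\<in>A. (f a / c) powr \<gamma>) \<longlongrightarrow> 0) at_bot"
  proof (rule tendsto_null_sum)
    fix a assume "a \<in> A"
    then have "f a / c > 1" using assms by simp
    then show "((\<lambda>\<gamma>. (f a / c) powr \<gamma>) \<longlongrightarrow> 0) at_bot" by (rule powr_tendsto_0)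
  qed
  then have "\<forall>\<^sub>F \<gamma> in at_bot. (\<Sum>a\<in>A. (f a / c) powr \<gamma>) < 1"
    by (rule order_tendstoD) simp
  then show ?thesis
  proof eventually_elim
    case (elim \<gamma>)
    have "(\<Sum>a\<in>A. f a powr \<gamma>) = c powr \<gamma> * (\<Sum>a\<in>A. (f a / c) powr \<gamma>)"
      unfolding sum_distrib_left using assms
      by (intro sum.cong) (auto simp: powr_divide dest: less_trans)
    also have "\<dots> < c powr \<gamma> * 1"
      using elim assms(1) by (intro mult_strict_left_mono) auto
    finally show ?case by simp
  qed
qed

text \<open>The same scaling, now with ratios below 1; a list retains repeated costs.\<close>

lemma eventually_sum_list_powr_less_at_top:
  fixes xs :: "real list"
  assumes "\<And>x. x \<in> set xs \<Longrightarrow> 0 < x \<and> x < c" "0 < c"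
  shows "\<forall>\<^sub>F \<gamma> in at_top. (\<Sum>x\<leftarrow>xs. x powr \<gamma>) < c powr \<gamma>"
proof -
  have "((\<lambda>\<gamma>. \<Sum>x\<leftarrow>xs. (x / c) powr \<gamma>) \<longlongrightarrow> 0) at_top"
    using assms(1)
  proof (induction xs)
    case (Cons x xs)
    then have "0 < x / c" "x / c < 1" using assms(2) by simp_all
    then have "((\<lambda>\<gamma>. (x / c) powr \<gamma>) \<longlongrightarrow> 0) at_top" by (rule powr_tendsto_0)
    with Cons show ?case by (simp add: tendsto_add_zero)
  qed simp
  then have "\<forall>\<^sub>F \<gamma> in at_top. (\<Sum>x\<leftarrow>xs. (x / c) powr \<gamma>) < 1"
    by (rule order_tendstoD) simp
  then show ?thesis
  proof eventually_elim
    case (elim \<gamma>)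
    have "(\<Sum>x\<leftarrow>xs. x powr \<gamma>) = (\<Sum>x\<leftarrow>xs. c powr \<gamma> * (x / c) powr \<gamma>)"
      using assms by (intro arg_cong[of _ _ sum_list] map_cong) (auto simp: powr_divide dest: less_trans)
    also have "\<dots> < c powr \<gamma> * 1"
      unfolding sum_list_const_mult using elim assms(2) by (intro mult_strict_left_mono) auto
    finally show ?case by simp
  qed
qed

text \<open>The common prefix cancels. At the first difference the entry \<open>b\<close> of
  \<open>ys\<close> exceeds all remaining entries of the descending list \<open>xs\<close>, so its
  power eventually dominates them. If \<open>xs\<close> is a proper prefix, \<open>ys\<close> has an
  extra positive term.\<close>

lemma eventually_sum_list_powr_less_of_lex_less:
  fixes xs ys :: "real list"
  assumes less: "xs < ys" and sorted: "sorted_wrt (\<ge>) xs"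
    and pos: "\<forall>x\<in>set xs. 0 < x" "\<forall>y\<in>set ys. 0 < y"
  shows "\<forall>\<^sub>F \<gamma> in at_top. (\<Sum>x\<leftarrow>xs. x powr \<gamma>) < (\<Sum>y\<leftarrow>ys. y powr \<gamma>)"
proof -
  have nonneg: "0 \<le> (\<Sum>z\<leftarrow>zs. z powr \<gamma>)" for zs :: "real list" and \<gamma>
    by (rule sum_list_nonneg) auto
  consider (prefix) b w where "ys = xs @ b # w"
    | (diff) u a b v w where "a < b" "xs = u @ a # v" "ys = u @ b # w"
    using less unfolding list_less_def lexord_def by fast
  then show ?thesis
  proof cases
    case (prefix b w)
    then show ?thesis using pos nonneg[of _ w] by (auto intro!: always_eventually add_pos_nonneg)
  next
    case (diff u a b v w)
    have "\<forall>\<^sub>F \<gamma> in at_top. (\<Sum>x\<leftarrow>a # v. x powr \<gamma>) < b powr \<gamma>"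
      by (rule eventually_sum_list_powr_less_at_top)
        (use diff sorted pos in \<open>auto simp: sorted_wrt_append\<close>)
    then show ?thesis
    proof eventually_elim
      case (elim \<gamma>)
      then show ?case using diff nonneg[of \<gamma> w] by simp
    qed
  qed
qed

section \<open>Total cost in terms of the descending list of costs\<close>

lemma sum_list_descending_costs:
  "(\<Sum>c\<leftarrow>descending_costs \<alpha> M. g c) = (\<Sum>(x, y)\<in>M. g (pair_cost \<alpha> x y) :: real)"
proof -
  have "(\<Sum>c\<leftarrow>descending_costs \<alpha> M. g c) = sum_mset (image_mset g (mset (descending_costs \<alpha> M)))"
    by (simp add: sum_mset_sum_list flip: mset_map)
  also have "\<dots> = (\<Sum>(x, y)\<in>M. g (pair_cost \<alpha> x y))"
    by (simp add: descending_costs_def sum_unfold_sum_mset multiset.map_comp comp_def case_prod_unfold)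
  finally show ?thesis .
qed

lemma sorted_descending_costs: "sorted_wrt (\<ge>) (descending_costs \<alpha> M)"
  by (simp add: descending_costs_def sorted_wrt_rev)

text \<open>Disjoint colours exclude edges of length 0. For infinite \<open>M\<close> the list is
  empty, since \<open>mset_set M\<close> is.\<close>

lemma descending_costs_pos:
  assumes "\<alpha> > 0" "R \<inter> B = {}" "is_matching R B M"
  shows "\<forall>c\<in>set (descending_costs \<alpha> M). 0 < c"
proof (cases "finite M")
  case True
  have "x \<noteq> y" if "(x, y) \<in> M" for x y
    using that assms(2,3) unfolding is_matching_def by auto
  then show ?thesis
    using True pair_cost_pos[OF assms(1)] by (auto simp: descending_costs_def)
qed (simp add: descending_costs_def)

text \<open>Both sides minimize over the same competitors, and any two of these are eventually
  ordered by cost as by their lists.\<close>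

lemma eventually_minimal_iff_altruistic:
  assumes fin: "finite R" "finite B" and disj: "R \<inter> B = {}" and \<alpha>: "\<alpha> > 0"
  shows "(\<forall>\<^sub>F \<gamma> in at_top. minimal_matching (cost_fun \<gamma> (\<alpha> powr \<gamma>)) R B M)
     \<longleftrightarrow> finite_altruistic \<alpha> R B M"
proof -
  define cost where "cost \<gamma> = total_cost (cost_fun \<gamma> (\<alpha> powr \<gamma>))" for \<gamma>
  have cost: "\<forall>\<^sub>F \<gamma> in at_top. cost \<gamma> N = (\<Sum>c\<leftarrow>descending_costs \<alpha> N. c powr \<gamma>)" for N
    using eventually_gt_at_top[of 0]
    by eventually_elim (simp add: cost_def total_cost_eq(1)[OF \<alpha>] sum_list_descending_costs)
  have matching: "is_matching R B N" if "fewest_unmatched R B N" for N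
    using that unfolding fewest_unmatched_def is_arg_min_def by blast
  have less: "\<forall>\<^sub>F \<gamma> in at_top. cost \<gamma> N < cost \<gamma> N'"
    if "fewest_unmatched R B N" "fewest_unmatched R B N'" "descending_costs \<alpha> N < descending_costs \<alpha> N'"
    for N N'
    using eventually_sum_list_powr_less_of_lex_less[OF that(3) sorted_descending_costs
        descending_costs_pos[OF \<alpha> disj matching[OF that(1)]]
        descending_costs_pos[OF \<alpha> disj matching[OF that(2)]]] cost[of N] cost[of N']
    by eventually_elim simp
  \<comment> \<open>Matchings with equal lists tie in cost for every positive \<gamma>, so the weak
    comparison transfers as well.\<close>
  have not_less: "\<forall>\<^sub>F \<gamma> in at_top. \<not> cost \<gamma> N' < cost \<gamma> N"
    if "fewest_unmatched R B N" "fewest_unmatched R B N'" "\<not> descending_costs \<alpha> N' < descending_costs \<alpha> N"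
    for N N'
  proof (cases "descending_costs \<alpha> N = descending_costs \<alpha> N'")
    case True
    show ?thesis using cost[of N] cost[of N'] by eventually_elim (simp add: True)
  next
    case False
    then have "descending_costs \<alpha> N < descending_costs \<alpha> N'" using that(3) by simp
    from less[OF that(1,2) this] show ?thesis by eventually_elim simp
  qed
  show ?thesis
  proof
    assume min: "\<forall>\<^sub>F \<gamma> in at_top. minimal_matching (cost_fun \<gamma> (\<alpha> powr \<gamma>)) R B M"
    then have M: "fewest_unmatched R B M"
      using eventually_happens'[OF trivial_limit_at_top_linorder] unfolding minimal_matching_def is_arg_min_def by blast
    have False if N: "fewest_unmatched R B N" "descending_costs \<alpha> N < descending_costs \<alpha> M" for N
    proof -
      obtain \<gamma> where "minimal_matching (cost_fun \<gamma> (\<alpha> powr \<gamma>)) R B M" "cost \<gamma> N < cost \<gamma> M"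
        using eventually_happens'[OF trivial_limit_at_top_linorder
            eventually_conj[OF min less[OF N(1) M N(2)]]] by blast
      with N(1) show False unfolding minimal_matching_def is_arg_min_def cost_def by blast
    qed
    with M show "finite_altruistic \<alpha> R B M"
      unfolding finite_altruistic_def is_arg_min_def by blast
  next
    assume alt: "finite_altruistic \<alpha> R B M"
    then have M: "fewest_unmatched R B M"
      unfolding finite_altruistic_def is_arg_min_def by blast
    have "finite {N. fewest_unmatched R B N}"
      by (rule finite_subset[OF _ finite_matchings[OF fin]]) (use matching in blast)
    \<comment> \<open>There are finitely many competitors, so their thresholds have a common
      bound.\<close>
    then have "\<forall>\<^sub>F \<gamma> in at_top. \<forall>N\<in>{N. fewest_unmatched R B N}. \<not> cost \<gamma> N < cost \<gamma> M"
      using M not_less alt by (intro eventually_ball_finite) (auto simp: finite_altruistic_def is_arg_min_def)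
    then show "\<forall>\<^sub>F \<gamma> in at_top. minimal_matching (cost_fun \<gamma> (\<alpha> powr \<gamma>)) R B M"
      by eventually_elim (use M in \<open>auto simp: minimal_matching_def is_arg_min_def cost_def\<close>)
  qed
qed

lemma limiting_minimal_iff_altruistic:
  assumes "R \<inter> B = {}" "\<alpha> > 0"
  shows "limiting_minimal at_top \<alpha> R B M \<longleftrightarrow> altruistic_matching \<alpha> R B M"
proof -
  have "(\<forall>\<^sub>F \<gamma> in at_top. minimal_matching (cost_fun \<gamma> (\<alpha> powr \<gamma>)) (R \<inter> S) (B \<inter> S) N)
     \<longleftrightarrow> finite_altruistic \<alpha> (R \<inter> S) (B \<inter> S) N" if "admissible R B M S" for S N
    using that assms by (intro eventually_minimal_iff_altruistic) (auto simp: admissible_def)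
  then show ?thesis
    unfolding limiting_minimal_def altruistic_matching_def by blast
qed

section \<open>Negative exponents and stable matchings\<close>

text \<open>An unmatched red point and an unmatched blue point would block, so one colour is fully
  matched and no matching has more edges.\<close>

lemma stable_fewest_unmatched:
  assumes fin: "finite R" "finite B" and disj: "R \<inter> B = {}" and M: "stable_matching \<alpha> R B M"
  shows "fewest_unmatched R B M"
proof -
  have match: "is_matching R B M" using M by (simp add: stable_matching_iff)
  have card_le: "card N \<le> card R" "card N \<le> card B" if "is_matching R B N" for N
  proof -
    have "fst ` N \<subseteq> R" "snd ` N \<subseteq> B" "inj_on fst N" "inj_on snd N"
      using that unfolding is_matching_def by auto
    then show "card N \<le> card R" "card N \<le> card B"
      using fin by (auto intro: card_inj_on_le)
  qed
  have "R \<subseteq> fst ` M \<or> B \<subseteq> snd ` M"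
    using M unfolding stable_matching_iff by (metis fst_conv image_eqI snd_conv subsetI)
  moreover have "finite M"
    using match fin unfolding is_matching_def by (meson finite_SigmaI finite_subset)
  ultimately have "card R \<le> card M \<or> card B \<le> card M"
    by (meson card_image_le card_mono finite_imageI order_trans)
  then have "card N \<le> card M" if "is_matching R B N" for N
    using card_le[OF that] by linarith
  moreover have "card (unmatched R B N) + 2 * card N = card (unmatched R B M) + 2 * card M"
    if "is_matching R B N" for N
    using card_unmatched[OF fin disj that] card_unmatched[OF fin disj match] by simp
  ultimately have "card (unmatched R B M) \<le> card (unmatched R B N)" if "is_matching R B N" for N
    using that by fastforce
  then show ?thesis
    unfolding fewest_unmatched_def is_arg_min_def using match by (meson not_le)
qed

text \<open>An edge of \<open>N - M\<close> is blocked by a strictly cheaper edge of \<open>M - N\<close>, hence the cheapest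
  edge of the symmetric difference lies in \<open>M\<close>, and its cost dominates as \<open>\<gamma> \<rightarrow> -\<infinity>\<close>.\<close>

lemma stable_eventually_cheapest:
  assumes fin: "finite R" "finite B" and disj: "R \<inter> B = {}" and \<alpha>: "\<alpha> > 0"
    and inj: "\<And>x. x \<in> R \<Longrightarrow> inj_on (pair_cost \<alpha> x) B"
      "\<And>y. y \<in> B \<Longrightarrow> inj_on (\<lambda>x. pair_cost \<alpha> x y) R"
    and M: "stable_matching \<alpha> R B M" and N: "is_matching R B N"
  shows "\<forall>\<^sub>F \<gamma> in at_bot. \<not> total_cost (cost_fun \<gamma> (\<alpha> powr \<gamma>)) N < total_cost (cost_fun \<gamma> (\<alpha> powr \<gamma>)) M"
proof (cases "N \<subseteq> M")
  \<comment> \<open>For negative \<gamma> no edge has positive cost, so removing edges from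
    \<open>M\<close> cannot lower the total.\<close>
  case True
  have "finite M"
    using M fin unfolding stable_matching_def is_matching_def by (meson finite_SigmaI finite_subset)
  show ?thesis
    using eventually_gt_at_bot[of 0]
  proof eventually_elim
    case (elim \<gamma>)
    then show ?case
      using sum_mono2[OF \<open>finite M\<close> True, of "\<lambda>(x, y). pair_cost \<alpha> x y powr \<gamma>"]
      by (auto simp: total_cost_eq(2)[OF \<alpha>] case_prod_unfold)
  qed
next
  case False
  define c where "c e = pair_cost \<alpha> (fst e) (snd e)" for e
  have matchM: "is_matching R B M" using M by (simp add: stable_matching_iff)
  have finM: "finite M" and finN: "finite N"
    using matchM N fin unfolding is_matching_def by (meson finite_SigmaI finite_subset)+
  have cheaper: "\<exists>g\<in>M - N. c g < c e" if "e \<in> N - M" for e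
  proof -
    obtain x y where "e = (x, y)" by (cases e)
    with that N have e: "e = (x, y)" "x \<in> R" "y \<in> B" "(x, y) \<in> N" "(x, y) \<notin> M"
      unfolding is_matching_def by auto
    then consider y' where "(x, y') \<in> M" "pair_cost \<alpha> x y' \<le> pair_cost \<alpha> x y"
      | x' where "(x', y) \<in> M" "pair_cost \<alpha> x' y \<le> pair_cost \<alpha> x y"
      using M unfolding stable_matching_iff by blast
    then show ?thesis
    proof cases
      case 1
      \<comment> \<open>Injectivity of the cost makes the inequality from stability strict; the
        cheaper edge is outside \<open>N\<close> because \<open>N\<close> already matches
        \<open>x\<close> to \<open>y\<close>.\<close>
      then have "y' \<in> B" "y' \<noteq> y" using e matchM unfolding is_matching_def by auto
      then have "pair_cost \<alpha> x y' \<noteq> pair_cost \<alpha> x y" using inj(1)[OF e(2)] e(3) by (auto dest: inj_onD)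
      moreover have "(x, y') \<notin> N" using e(4) \<open>y' \<noteq> y\<close> is_matchingD_fst[OF N] by blast
      ultimately show ?thesis using 1 by (intro bexI[of _ "(x, y')"]) (auto simp: c_def e(1))
    next
      case 2
      then have "x' \<in> R" "x' \<noteq> x" using e matchM unfolding is_matching_def by auto
      then have "pair_cost \<alpha> x' y \<noteq> pair_cost \<alpha> x y" using inj(2)[OF e(3)] e(2) by (auto dest: inj_onD)
      moreover have "(x', y) \<notin> N" using e(4) \<open>x' \<noteq> x\<close> is_matchingD_snd[OF N] by blast
      ultimately show ?thesis using 2 by (intro bexI[of _ "(x', y)"]) (auto simp: c_def e(1))
    qed
  qed
  have "M - N \<noteq> {}" using False cheaper by blast
  then obtain g where g: "g \<in> M - N" "\<And>e. e \<in> M - N \<Longrightarrow> c g \<le> c e"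
    using finM by (metis arg_min_least arg_min_if_finite(1) finite_Diff)
  have "fst g \<in> R" "snd g \<in> B"
    using g(1) matchM unfolding is_matching_def by (auto simp: mem_Times_iff)
  then have "c g > 0"
    unfolding c_def using disj by (intro pair_cost_pos[OF \<alpha>]) auto
  moreover have "c g < c e" if "e \<in> N - M" for e
    using cheaper[OF that] g(2) by (meson le_less_trans)
  ultimately have "\<forall>\<^sub>F \<gamma> in at_bot. (\<Sum>e\<in>N - M. c e powr \<gamma>) < c g powr \<gamma>"
    by (rule eventually_sum_powr_less_at_bot)
  then show ?thesis
    using eventually_gt_at_bot[of 0]
  proof eventually_elim
    case (elim \<gamma>)
    have "c g powr \<gamma> \<le> (\<Sum>e\<in>M - N. c e powr \<gamma>)"
      using g(1) finM by (intro member_le_sum) auto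
    \<comment> \<open>The shared edges cancel, leaving \<open>c g powr \<gamma>\<close> against the
      sum over \<open>N - M\<close>.\<close>
    moreover have "(\<Sum>e\<in>M. c e powr \<gamma>) = (\<Sum>e\<in>M - N. c e powr \<gamma>) + (\<Sum>e\<in>M \<inter> N. c e powr \<gamma>)"
      "(\<Sum>e\<in>N. c e powr \<gamma>) = (\<Sum>e\<in>N - M. c e powr \<gamma>) + (\<Sum>e\<in>M \<inter> N. c e powr \<gamma>)"
      using sum.Int_Diff[OF finM, of "\<lambda>e. c e powr \<gamma>" N] sum.Int_Diff[OF finN, of "\<lambda>e. c e powr \<gamma>" M]
      by (simp_all add: Int_commute)
    ultimately show ?case
      using elim by (simp add: total_cost_eq(2)[OF \<alpha>] case_prod_unfold c_def)
  qed
qed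

text \<open>\<open>M\<close> is compared with all matchings of the finite sets; as these are
  finitely many, one threshold for \<gamma> serves them all.\<close>

lemma stable_eventually_minimal:
  assumes fin: "finite R" "finite B" and disj: "R \<inter> B = {}" and \<alpha>: "\<alpha> > 0"
    and inj: "\<And>x. x \<in> R \<Longrightarrow> inj_on (pair_cost \<alpha> x) B"
      "\<And>y. y \<in> B \<Longrightarrow> inj_on (\<lambda>x. pair_cost \<alpha> x y) R"
    and M: "stable_matching \<alpha> R B M"
  shows "\<forall>\<^sub>F \<gamma> in at_bot. minimal_matching (cost_fun \<gamma> (\<alpha> powr \<gamma>)) R B M"
proof -
  have "\<forall>\<^sub>F \<gamma> in at_bot. \<forall>N\<in>{N. is_matching R B N}.
      \<not> total_cost (cost_fun \<gamma> (\<alpha> powr \<gamma>)) N < total_cost (cost_fun \<gamma> (\<alpha> powr \<gamma>)) M"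
    using stable_eventually_cheapest[OF fin disj \<alpha> inj M] finite_matchings[OF fin]
    by (intro eventually_ball_finite) auto
  then show ?thesis
    by eventually_elim (use stable_fewest_unmatched[OF fin disj M] in
      \<open>auto simp: minimal_matching_def is_arg_min_def fewest_unmatched_def\<close>)
qed

section \<open>Blocking pairs contradict minimality\<close>

text \<open>If \<open>N\<close> has more edges, then \<open>M\<close> leaves too many points
  unmatched. Otherwise \<open>N\<close> is an eligible competitor, and the assumed cost comparison
  applies.\<close>

lemma not_eventually_minimal:
  assumes fin: "finite R" "finite B" and disj: "R \<inter> B = {}"
    and M: "is_matching R B M" and N: "is_matching R B N" and "card M \<le> card N"
    and less: "\<forall>\<^sub>F \<gamma> in at_bot. card M = card N \<longrightarrow>
      total_cost (cost_fun \<gamma> (\<alpha> powr \<gamma>)) N < total_cost (cost_fun \<gamma> (\<alpha> powr \<gamma>)) M"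
  shows "\<not> (\<forall>\<^sub>F \<gamma> in at_bot. minimal_matching (cost_fun \<gamma> (\<alpha> powr \<gamma>)) R B M)"
proof
  assume min: "\<forall>\<^sub>F \<gamma> in at_bot. minimal_matching (cost_fun \<gamma> (\<alpha> powr \<gamma>)) R B M"
  then have few: "fewest_unmatched R B M"
    using eventually_happens'[OF trivial_limit_at_bot_linorder]
    unfolding minimal_matching_def is_arg_min_def by blast
  then have "card (unmatched R B M) \<le> card (unmatched R B N)"
    using N unfolding fewest_unmatched_def is_arg_min_def by force
  then have eq: "card M = card N"
    using card_unmatched[OF fin disj M] card_unmatched[OF fin disj N] \<open>card M \<le> card N\<close> by simp
  then have "card (unmatched R B N) \<le> card (unmatched R B M)"
    using card_unmatched[OF fin disj M] card_unmatched[OF fin disj N] by simp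
  then have "fewest_unmatched R B N"
    using few N is_arg_min_mono unfolding fewest_unmatched_def by metis
  moreover obtain \<gamma> where "minimal_matching (cost_fun \<gamma> (\<alpha> powr \<gamma>)) R B M"
      "total_cost (cost_fun \<gamma> (\<alpha> powr \<gamma>)) N < total_cost (cost_fun \<gamma> (\<alpha> powr \<gamma>)) M"
    using eventually_happens'[OF trivial_limit_at_bot_linorder eventually_conj[OF min less]] eq by blast
  ultimately show False unfolding minimal_matching_def is_arg_min_def by blast
qed

lemma stable_of_limiting_minimal:
  assumes disj: "R \<inter> B = {}" and \<alpha>: "\<alpha> > 0" and lim: "limiting_minimal at_bot \<alpha> R B M"
  shows "stable_matching \<alpha> R B M"
proof -
  have match: "is_matching R B M" using lim by (simp add: limiting_minimal_def)
  have sub: "a \<in> R \<and> b \<in> B" if "(a, b) \<in> M" for a b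
    using that match unfolding is_matching_def by auto
  have False if xy: "x \<in> R" "y \<in> B" "(x, y) \<notin> M"
    and red: "\<And>y'. (x, y') \<in> M \<Longrightarrow> pair_cost \<alpha> x y < pair_cost \<alpha> x y'"
    and blue: "\<And>x'. (x', y) \<in> M \<Longrightarrow> pair_cost \<alpha> x y < pair_cost \<alpha> x' y" for x y
  proof -
    \<comment> \<open>For a blocking pair, the smallest relevant admissible set suffices:
      \<open>x\<close>, \<open>y\<close> and their partners, if any.\<close>
    define E where "E = {e \<in> M. fst e = x \<or> snd e = y}"
    define U where "U = {x, y} \<inter> unmatched R B M"
    define S where "S = (\<Union>(x, y)\<in>E. {x, y}) \<union> U"
    have E_eq: "E = {x} \<times> {y'. (x, y') \<in> M} \<union> {x'. (x', y) \<in> M} \<times> {y}"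
      unfolding E_def by auto
    \<comment> \<open>The swap: the product holds the edge between the former partners if both exist
      and is empty otherwise. The edge count stays the same, or rises from 0 to 1 if both
      \<open>x\<close> and \<open>y\<close> were unmatched.\<close>
    define N where "N = insert (x, y) ({x'. (x', y) \<in> M} \<times> {y'. (x, y') \<in> M})"
    have "x \<noteq> y" using xy disj by blast
    then have pos: "0 < pair_cost \<alpha> x y" by (rule pair_cost_pos[OF \<alpha>])
    have uniq: "\<exists>Y. {y'. (x, y') \<in> M} \<subseteq> {Y}" "\<exists>X. {x'. (x', y) \<in> M} \<subseteq> {X}"
      using is_matchingD_fst[OF match] is_matchingD_snd[OF match] by (blast, blast)
    have finE: "finite E"
      using uniq unfolding E_eq by (auto intro: finite_subset)
    have finS: "finite S" unfolding S_def U_def using finE by auto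
    have adm: "admissible R B M S"
      unfolding admissible_def using finS by (intro conjI exI[of _ E] exI[of _ U]) (auto simp: E_def U_def S_def)
    have in_S: "x \<in> S" "y \<in> S"
      using xy disj unfolding S_def U_def unmatched_def E_def by force+
    have restrict: "restrict_matching M S = E"
    proof
      show "E \<subseteq> restrict_matching M S" unfolding restrict_matching_def S_def E_def by auto
      show "restrict_matching M S \<subseteq> E"
      proof
        fix e assume "e \<in> restrict_matching M S"
        then obtain a b where e: "e = (a, b)" "(a, b) \<in> M" "a \<in> S" unfolding restrict_matching_def by auto
        then have "a \<notin> B" "a \<notin> unmatched R B M" using sub disj by (auto simp: unmatched_def rev_image_eqI)
        then obtain b' where "(a, b') \<in> E" using e(3) sub unfolding S_def U_def E_def by fastforce
        then show "e \<in> E" using e is_matchingD_fst[OF match, of a b b'] unfolding E_def by auto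
      qed
    qed
    have ev: "\<forall>\<^sub>F \<gamma> in at_bot. minimal_matching (cost_fun \<gamma> (\<alpha> powr \<gamma>)) (R \<inter> S) (B \<inter> S) E"
      using lim adm unfolding limiting_minimal_def restrict[symmetric] by blast
    \<comment> \<open>Both members of a blocking pair strictly prefer each other, so every edge in
      \<open>E\<close> costs more than \<open>(x, y)\<close>.\<close>
    have less: "\<forall>\<^sub>F \<gamma> in at_bot. (\<Sum>e\<in>E. pair_cost \<alpha> (fst e) (snd e) powr \<gamma>) < pair_cost \<alpha> x y powr \<gamma>"
      using pos by (rule eventually_sum_powr_less_at_bot) (auto simp: E_eq red blue)
    have matchN: "is_matching (R \<inter> S) (B \<inter> S) N"
    proof -
      have "x' \<noteq> x" if "(x', y) \<in> M" for x' using that xy(3) by blast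
      moreover have "y' \<noteq> y" if "(x, y') \<in> M" for y' using that xy(3) by blast
      ultimately have "inj_on fst N" "inj_on snd N"
        unfolding N_def inj_on_def
        using is_matchingD_fst[OF match, of x] is_matchingD_snd[OF match, of _ y] by auto
      moreover have "N \<subseteq> (R \<inter> S) \<times> (B \<inter> S)"
        using xy in_S sub unfolding N_def S_def E_def by fastforce
      ultimately show ?thesis unfolding is_matching_def by simp
    qed
    have finN: "finite N" using uniq unfolding N_def by (auto intro: finite_subset)
    have card: "card E \<le> card N"
    proof -
      obtain X Y where XY: "{y'. (x, y') \<in> M} = {} \<or> {y'. (x, y') \<in> M} = {Y}"
        "{x'. (x', y) \<in> M} = {} \<or> {x'. (x', y) \<in> M} = {X}"
        using uniq by (metis subset_singleton_iff)
      then have "(x, y) \<notin> {x'. (x', y) \<in> M} \<times> {y'. (x, y') \<in> M}" using xy(3) by blast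
      with XY show ?thesis unfolding E_eq N_def by (elim disjE) (auto simp: card_insert_if)
    qed
    have "\<not> (\<forall>\<^sub>F \<gamma> in at_bot. minimal_matching (cost_fun \<gamma> (\<alpha> powr \<gamma>)) (R \<inter> S) (B \<inter> S) E)"
    proof (rule not_eventually_minimal[OF _ _ _ _ matchN card])
      show "finite (R \<inter> S)" "finite (B \<inter> S)" "R \<inter> S \<inter> (B \<inter> S) = {}" using finS disj by auto
      show "is_matching (R \<inter> S) (B \<inter> S) E"
        using is_matching_restrict[OF match] unfolding restrict[symmetric] .
      show "\<forall>\<^sub>F \<gamma> in at_bot. card E = card N \<longrightarrow>
          total_cost (cost_fun \<gamma> (\<alpha> powr \<gamma>)) N < total_cost (cost_fun \<gamma> (\<alpha> powr \<gamma>)) E"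
        using less eventually_gt_at_bot[of 0]
      proof eventually_elim
        case (elim \<gamma>)
        \<comment> \<open>The new edge alone outweighs \<open>E\<close>; a possible second edge of
          \<open>N\<close> only lowers the signed cost further.\<close>
        have "pair_cost \<alpha> x y powr \<gamma> \<le> (\<Sum>e\<in>N. pair_cost \<alpha> (fst e) (snd e) powr \<gamma>)"
          using member_le_sum[of "(x, y)" N "\<lambda>e. pair_cost \<alpha> (fst e) (snd e) powr \<gamma>"] finN
          by (simp add: N_def)
        then show ?case using elim by (simp add: total_cost_eq(2)[OF \<alpha>] case_prod_unfold)
      qed
    qed
    with ev show False by blast
  qed
  then show ?thesis
    unfolding stable_matching_iff using match by (meson not_le_imp_less)
qed

lemma limiting_minimal_iff_stable:
  assumes disj: "R \<inter> B = {}" and \<alpha>: "\<alpha> > 0"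
    and inj: "\<And>x. x \<in> R \<Longrightarrow> inj_on (pair_cost \<alpha> x) B"
      "\<And>y. y \<in> B \<Longrightarrow> inj_on (\<lambda>x. pair_cost \<alpha> x y) R"
  shows "limiting_minimal at_bot \<alpha> R B M \<longleftrightarrow> stable_matching \<alpha> R B M"
proof
  assume M: "stable_matching \<alpha> R B M"
  have "\<forall>\<^sub>F \<gamma> in at_bot. minimal_matching (cost_fun \<gamma> (\<alpha> powr \<gamma>)) (R \<inter> S) (B \<inter> S)
      (restrict_matching M S)" if adm: "admissible R B M S" for S
  proof (rule stable_eventually_minimal[OF _ _ _ \<alpha> _ _ stable_matching_restrict[OF M disj adm]])
    show "finite (R \<inter> S)" "finite (B \<inter> S)" using adm by (auto simp: admissible_def)
  qed (use disj in \<open>auto intro: inj_on_subset[OF inj(1)] inj_on_subset[OF inj(2)]\<close>)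
  with M show "limiting_minimal at_bot \<alpha> R B M"
    unfolding limiting_minimal_def stable_matching_def by blast
qed (rule stable_of_limiting_minimal[OF disj \<alpha>])

section \<open>Cost ties as coincidences, and the almost sure statement\<close>

text \<open>Solves a tie \<open>s * (x - y) = y' - x\<close> for the middle point.\<close>

lemma weighted_mean_eq:
  fixes s :: real
  assumes "s > 0" "x * (1 + s) = s * y + y'"
  shows "x = s / (1 + s) * y + (1 - s / (1 + s)) * y'"
proof -
  have "1 - s / (1 + s) = 1 / (1 + s)" using assms(1) by (simp add: field_simps)
  then have "s / (1 + s) * y + (1 - s / (1 + s)) * y' = (s * y + y') / (1 + s)"
    by (simp add: add_divide_distrib)
  also have "\<dots> = x" using assms(1) unfolding assms(2)[symmetric] by simp
  finally show ?thesis by simp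
qed

text \<open>On either side of \<open>x\<close> the cost is strictly monotone in the distance, so a
  tie between different points has them on opposite sides. This makes \<open>x\<close> an excluded
  weighted mean.\<close>

lemma pair_cost_red_inj:
  assumes \<alpha>: "\<alpha> > 0"
    and avoid: "\<And>y y'. y \<in> B \<Longrightarrow> y' \<in> B \<Longrightarrow> x \<noteq> \<alpha> / (1 + \<alpha>) * y + (1 - \<alpha> / (1 + \<alpha>)) * y'"
  shows "inj_on (pair_cost \<alpha> x) B"
proof -
  have comb: "x = \<alpha> / (1 + \<alpha>) * y + (1 - \<alpha> / (1 + \<alpha>)) * y'" if "\<alpha> * (x - y) = y' - x" for y y'
    using that by (intro weighted_mean_eq[OF \<alpha>]) (simp add: algebra_simps)
  show ?thesis
  proof (rule inj_onI)
    fix y y' assume y: "y \<in> B" "y' \<in> B" and eq: "pair_cost \<alpha> x y = pair_cost \<alpha> x y'"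
    have "\<alpha> * (x - y) \<noteq> y' - x" "\<alpha> * (x - y') \<noteq> y - x"
      using avoid y comb by blast+
    then show "y = y'" using eq \<alpha> by (auto simp: pair_cost_def abs_if split: if_splits)
  qed
qed

text \<open>The mirrored argument: seen from a blue point, the factor \<alpha> belongs to red points
  on its right, so the right one takes the weight \<open>\<alpha> / (1 + \<alpha>)\<close>.\<close>

lemma pair_cost_blue_inj:
  assumes \<alpha>: "\<alpha> > 0"
    and avoid: "\<And>x x'. x \<in> R \<Longrightarrow> x' \<in> R \<Longrightarrow> y \<noteq> \<alpha> / (1 + \<alpha>) * x + (1 - \<alpha> / (1 + \<alpha>)) * x'"
  shows "inj_on (\<lambda>x. pair_cost \<alpha> x y) R"
proof -
  have comb: "y = \<alpha> / (1 + \<alpha>) * x' + (1 - \<alpha> / (1 + \<alpha>)) * x" if "y - x = \<alpha> * (x' - y)" for x x'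
    using that by (intro weighted_mean_eq[OF \<alpha>]) (simp add: algebra_simps)
  show ?thesis
  proof (rule inj_onI)
    fix x x' assume x: "x \<in> R" "x' \<in> R" and eq: "pair_cost \<alpha> x y = pair_cost \<alpha> x' y"
    have "y - x \<noteq> \<alpha> * (x' - y)" "y - x' \<noteq> \<alpha> * (x - y)"
      using avoid x comb by blast+
    then show "x = x'" using eq \<alpha> by (auto simp: pair_cost_def abs_if split: if_splits)
  qed
qed

theorem theorem1p5:
  fixes \<Omega> :: "'w measure" and R B :: "'w \<Rightarrow> real set" and \<alpha> :: real
  assumes "prob_space \<Omega>"
    and "poisson_point_process \<Omega> 1 R"
    and "poisson_point_process \<Omega> 1 B"
    and "prob_space.indep_var \<Omega> configuration_space R configuration_space B"
    and "\<alpha> > 0"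
  shows "AE \<omega> in \<Omega>.
           (\<forall>M. limiting_minimal at_bot \<alpha> (R \<omega>) (B \<omega>) M \<longleftrightarrow> stable_matching \<alpha> (R \<omega>) (B \<omega>) M) \<and>
           (\<forall>M. limiting_minimal at_top \<alpha> (R \<omega>) (B \<omega>) M \<longleftrightarrow> altruistic_matching \<alpha> (R \<omega>) (B \<omega>) M)"
proof -
  interpret prob_space \<Omega> by fact
  let ?t = "\<alpha> / (1 + \<alpha>)"
  have t: "0 \<le> ?t" "?t \<le> 1" using \<open>\<alpha> > 0\<close> by auto
  \<comment> \<open>Ties at a blue point involve two red points, hence the second application with
    the processes exchanged.\<close>
  have "indep_var configuration_space B configuration_space R"
    using assms(4) by (rule indep_var_commute)
  then have "AE \<omega> in \<Omega>. \<forall>y\<in>B \<omega>. \<forall>x\<in>R \<omega>. \<forall>x'\<in>R \<omega>. y \<noteq> ?t * x + (1 - ?t) * x'"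
    by (rule AE_poisson_avoids_combinations[OF assms(3,2) _ t])
  with AE_poisson_avoids_combinations[OF assms(2-4) t] show ?thesis
  proof eventually_elim
    case (elim \<omega>)
    have "x \<noteq> y" if "x \<in> R \<omega>" "y \<in> B \<omega>" for x y
    proof -
      have "x \<noteq> ?t * y + (1 - ?t) * y" using elim(1) that by blast
      moreover have "?t * y + (1 - ?t) * y = y" by (simp add: left_diff_distrib)
      ultimately show ?thesis by simp
    qed
    then have disj: "R \<omega> \<inter> B \<omega> = {}" by blast
    have "inj_on (pair_cost \<alpha> x) (B \<omega>)" if "x \<in> R \<omega>" for x
      using elim(1) that by (intro pair_cost_red_inj[OF \<open>\<alpha> > 0\<close>]) blast
    moreover have "inj_on (\<lambda>x. pair_cost \<alpha> x y) (R \<omega>)" if "y \<in> B \<omega>" for y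
      using elim(2) that by (intro pair_cost_blue_inj[OF \<open>\<alpha> > 0\<close>]) blast
    ultimately show ?case
      using limiting_minimal_iff_stable[OF disj \<open>\<alpha> > 0\<close>]
        limiting_minimal_iff_altruistic[OF disj \<open>\<alpha> > 0\<close>] by blast
  qed
qed

end
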